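(* The variety $\mathbf{V}(I_S)\subset E(a,b)=k^{2\ell}$ of the Sibirsky ideal $I_S$ is the Zariski closure of the set $\mathcal{R}\subset E(a,b)$ of all time-reversible systems in the family $$\frac{dx}{dt}=-\sum_{(p,q)\in S}a_{pq}x^{p+1}y^{q}=P(x,y),\qquad \frac{dy}{dt}=\sum_{(p,q)\in S}b_{qp}x^{q}y^{p+1}=Q(x,y),$$ that is, $\overline{\mathcal{R}}=\mathbf{V}(I_S)$.
   Context: Let $k$ be an infinite field (e.g. $\mathbb{R}$ or $\mathbb{C}$), let $\mathbb{N}_0$ be the set of nonnegative integers, and fix a finite set of $\ell$ distinct pairs $S=\{(p_j,q_j)\mid p_j+q_j\ge 0,\ j=1,\dots,\ell\}\subset(\{-1\}\cup\mathbb{N}_0)\times\mathbb{N}_0$. The parameters $a_{p_jq_j},b_{q_jp_j}$ ($j=1,\dots,\ell$) of the family take values in $k$. Write $(a,b)=(a_{p_1q_1},\dots,a_{p_\ell q_\ell},b_{q_\ell p_\ell},\dots,b_{q_1p_1})$ for the ordered vector of coefficients (note the reversed order of the $b$'s); $E(a,b)=k^{2\ell}$ is the parameter space, whose points are identified with systems of the family, and $k[a,b]$ is the polynomial ring over $k$ in the $2\ell$ variables $a_{p_jq_j},b_{q_jp_j}$. A system $(a,b)\in E(a,b)$ is time-reversible if it is time-reversible with respect to the map $x\mapsto\gamma y,\ y\mapsto\gamma^{-1}x$ for some nonzero $\gamma\in k$, i.e. if for some nonzero $\gamma\in k$ the polynomial identities $\gamma Q(\gamma y,x/\gamma)=-P(x,y)$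 and $\gamma Q(x,y)=-P(\gamma y,x/\gamma)$ hold; equivalently, for some nonzero $\gamma\in k$, $b_{qp}=\gamma^{p-q}a_{pq}$ for all $(p,q)\in S$. Let $\zeta=(p_1-q_1,\dots,p_\ell-q_\ell,q_\ell-p_\ell,\dots,q_1-p_1)\in\mathbb{Z}^{2\ell}$ and let $\mathcal{M}=\{\nu\in\mathbb{N}_0^{2\ell}\mid \zeta_1\nu_1+\cdots+\zeta_{2\ell}\nu_{2\ell}=0\}$. For $\nu=(\nu_1,\dots,\nu_{2\ell})\in\mathbb{N}_0^{2\ell}$ put $[\nu]=a_{p_1q_1}^{\nu_1}\cdots a_{p_\ell q_\ell}^{\nu_\ell}b_{q_\ell p_\ell}^{\nu_{\ell+1}}\cdots b_{q_1p_1}^{\nu_{2\ell}}$ and $\hat\nu=(\nu_{2\ell},\nu_{2\ell-1},\dots,\nu_1)$. The Sibirsky ideal is $I_S=\langle[\nu]-[\hat\nu]\mid\nu\in\mathcal{M}\rangle\subset k[a,b]$. For an ideal $I\subset k[a,b]$, $\mathbf{V}(I)\subset k^{2\ell}$ is the set of common zeros in $k^{2\ell}$ of all polynomials of $I$. The Zariski closure $\overline{W}$ of $W\subset k^{2\ell}$ is the smallest such variety containing $W$. *)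

theory Defs
  imports "HOL-Algebra.Ideal" "HOL-Library.Poly_Mapping" "HOL-Library.FuncSet"
begin

section \<open>Multivariate polynomials\<close>

text \<open>
  The type of polynomials with coefficients in \<open>'k\<close> and variables indexed by \<open>'v\<close>: an element of
  \<open>'v \<Rightarrow>\<^sub>0 nat\<close> is an exponent vector, and the ring operations (with the convolution product) are
  those of \<^theory>\<open>HOL-Library.Poly_Mapping\<close>.
\<close>

type_synonym ('v, 'k) mpoly = "('v \<Rightarrow>\<^sub>0 nat) \<Rightarrow>\<^sub>0 'k"

definition mconst :: "'k::zero \<Rightarrow> ('v, 'k) mpoly" where
  "mconst c = Poly_Mapping.single 0 c"

definition mvar :: "'v \<Rightarrow> ('v, 'k::zero_neq_one) mpoly" where
  "mvar v = Poly_Mapping.single (Poly_Mapping.single v 1) 1"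

definition vars :: "('v, 'k::zero) mpoly \<Rightarrow> 'v set" where
  "vars f = (\<Union>m\<in>Poly_Mapping.keys f. Poly_Mapping.keys m)"

text \<open>
  Substitution of \<open>x v\<close> for each variable \<open>v\<close>, with coefficients mapped by \<open>\<phi>\<close>. Taking \<open>\<phi> = id\<close> gives
  the value at a point, and \<open>\<phi> = mconst\<close> gives substitution of polynomials for the variables.
\<close>

definition msubst ::
    "('k::zero \<Rightarrow> 'r::comm_semiring_1) \<Rightarrow> ('v \<Rightarrow> 'r) \<Rightarrow> ('v, 'k) mpoly \<Rightarrow> 'r" where
  "msubst \<phi> x f = (\<Sum>m\<in>Poly_Mapping.keys f.
     \<phi> (Poly_Mapping.lookup f m) *
     (\<Prod>v\<in>Poly_Mapping.keys m. x v ^ Poly_Mapping.lookup m v))"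

definition mpoly_ring :: "'v set \<Rightarrow> ('v, 'k::comm_ring_1) mpoly ring" where
  "mpoly_ring X =
     \<lparr>carrier = {f. vars f \<subseteq> X}, monoid.mult = (*), one = 1, ring.zero = 0, add = (+)\<rparr>"

lemma cring_mpoly_ring: "cring (mpoly_ring X :: ('v, 'k::comm_ring_1) mpoly ring)"
proof -
  have add: "vars (f + g) \<subseteq> X" if "vars f \<subseteq> X" "vars g \<subseteq> X" for f g :: "('v, 'k) mpoly"
    using that Poly_Mapping.keys_add[of f g] unfolding vars_def by blast
  have mult: "vars (f * g) \<subseteq> X" if f: "vars f \<subseteq> X" and g: "vars g \<subseteq> X"
    for f g :: "('v, 'k) mpoly"
  proof
    fix v assume "v \<in> vars (f * g)"
    then obtain m where m: "m \<in> Poly_Mapping.keys (f * g)" "v \<in> Poly_Mapping.keys m"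
      unfolding vars_def by blast
    from m(1) obtain m1 m2 where "m = m1 + m2" "m1 \<in> Poly_Mapping.keys f" "m2 \<in> Poly_Mapping.keys g"
      using keys_mult[of f g] by blast
    then show "v \<in> X"
      using m(2) f g Poly_Mapping.keys_add[of m1 m2] unfolding vars_def by blast
  qed
  have uminus: "vars (- f) = vars f" for f :: "('v, 'k) mpoly"
    by (simp add: vars_def)
  have zero_one: "vars (0 :: ('v, 'k) mpoly) \<subseteq> X" "vars (1 :: ('v, 'k) mpoly) \<subseteq> X"
    by (simp_all add: vars_def)
  show ?thesis
  proof (rule cringI)
    show "abelian_group (mpoly_ring X :: ('v, 'k) mpoly ring)"
    proof (rule abelian_groupI, goal_cases)
      case (6 f)
      then show ?case
        by (intro bexI[of _ "- f"]) (auto simp: mpoly_ring_def uminus)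
    qed (auto simp: mpoly_ring_def zero_one algebra_simps dest: add)
    show "comm_monoid (mpoly_ring X :: ('v, 'k) mpoly ring)"
      by (rule comm_monoidI) (auto simp: mpoly_ring_def zero_one algebra_simps dest: mult)
  qed (auto simp: mpoly_ring_def algebra_simps)
qed

section \<open>Affine varieties\<close>

definition affine_space :: "nat \<Rightarrow> (nat \<Rightarrow> 'k) set" where
  "affine_space n = {1..n} \<rightarrow>\<^sub>E UNIV"

definition zero_set :: "nat \<Rightarrow> (nat, 'k::comm_ring_1) mpoly set \<Rightarrow> (nat \<Rightarrow> 'k) set" where
  "zero_set n I = {c \<in> affine_space n. \<forall>f\<in>I. msubst id c f = 0}"

definition affine_variety :: "nat \<Rightarrow> (nat \<Rightarrow> 'k::comm_ring_1) set \<Rightarrow> bool" where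
  "affine_variety n V \<longleftrightarrow> (\<exists>I. ideal I (mpoly_ring {1..n}) \<and> V = zero_set n I)"

definition zariski_closure :: "nat \<Rightarrow> (nat \<Rightarrow> 'k::comm_ring_1) set \<Rightarrow> (nat \<Rightarrow> 'k) set" where
  "zariski_closure n W = (LEAST V. affine_variety n V \<and> W \<subseteq> V)"

section \<open>Time-reversible systems\<close>

text \<open>
  The family is given by an enumeration \<open>(p j, q j)\<close>, \<open>1 \<le> j \<le> l\<close>, of the set \<open>S\<close>. In a point \<open>c\<close> of
  \<open>affine_space (2 * l)\<close>, the coefficient belonging to \<open>x\<^bsup>p j + 1\<^esup> y\<^bsup>q j\<^esup>\<close> is \<open>c j\<close> and the one
  belonging to \<open>x\<^bsup>q j\<^esup> y\<^bsup>p j + 1\<^esup>\<close> is \<open>c (2 * l + 1 - j)\<close>, since the latter coefficients are listed in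
  reversed order.
\<close>

datatype xy = VarX | VarY

definition P_poly :: "nat \<Rightarrow> (nat \<Rightarrow> int) \<Rightarrow> (nat \<Rightarrow> nat) \<Rightarrow> (nat \<Rightarrow> 'k::field) \<Rightarrow> (xy, 'k) mpoly" where
  "P_poly l p q c = - (\<Sum>j=1..l. mconst (c j) * mvar VarX ^ nat (p j + 1) * mvar VarY ^ q j)"

definition Q_poly :: "nat \<Rightarrow> (nat \<Rightarrow> int) \<Rightarrow> (nat \<Rightarrow> nat) \<Rightarrow> (nat \<Rightarrow> 'k::field) \<Rightarrow> (xy, 'k) mpoly" where
  "Q_poly l p q c =
     (\<Sum>j=1..l. mconst (c (2 * l + 1 - j)) * mvar VarX ^ q j * mvar VarY ^ nat (p j + 1))"

text \<open>The polynomial \<open>f(\<gamma> y, x / \<gamma>)\<close>.\<close>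

definition swap_subst :: "'k::field \<Rightarrow> (xy, 'k) mpoly \<Rightarrow> (xy, 'k) mpoly" where
  "swap_subst \<gamma> f =
     msubst mconst (\<lambda>v. case v of VarX \<Rightarrow> mconst \<gamma> * mvar VarY | VarY \<Rightarrow> mconst (1 / \<gamma>) * mvar VarX) f"

definition time_reversible ::
    "nat \<Rightarrow> (nat \<Rightarrow> int) \<Rightarrow> (nat \<Rightarrow> nat) \<Rightarrow> (nat \<Rightarrow> 'k::field) \<Rightarrow> bool" where
  "time_reversible l p q c \<longleftrightarrow> (\<exists>\<gamma>. \<gamma> \<noteq> 0 \<and>
     mconst \<gamma> * swap_subst \<gamma> (Q_poly l p q c) = - P_poly l p q c \<and>
     mconst \<gamma> * Q_poly l p q c = - swap_subst \<gamma> (P_poly l p q c))"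

definition time_reversible_systems ::
    "nat \<Rightarrow> (nat \<Rightarrow> int) \<Rightarrow> (nat \<Rightarrow> nat) \<Rightarrow> (nat \<Rightarrow> 'k::field) set" where
  "time_reversible_systems l p q = {c \<in> affine_space (2 * l). time_reversible l p q c}"

section \<open>The Sibirsky ideal\<close>

definition zeta :: "nat \<Rightarrow> (nat \<Rightarrow> int) \<Rightarrow> (nat \<Rightarrow> nat) \<Rightarrow> nat \<Rightarrow> int" where
  "zeta l p q i =
     (if i \<le> l then p i - int (q i) else int (q (2 * l + 1 - i)) - p (2 * l + 1 - i))"

definition sibirsky_monoid :: "nat \<Rightarrow> (nat \<Rightarrow> int) \<Rightarrow> (nat \<Rightarrow> nat) \<Rightarrow> (nat \<Rightarrow> nat) set" where
  "sibirsky_monoid l p q =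
     {\<nu> \<in> {1..2 * l} \<rightarrow>\<^sub>E UNIV. (\<Sum>i=1..2 * l. zeta l p q i * int (\<nu> i)) = 0}"

definition coeff_monomial :: "nat \<Rightarrow> (nat \<Rightarrow> nat) \<Rightarrow> (nat, 'k::comm_ring_1) mpoly" where
  "coeff_monomial l \<nu> = (\<Prod>i=1..2 * l. mvar i ^ \<nu> i)"

definition hat :: "nat \<Rightarrow> (nat \<Rightarrow> nat) \<Rightarrow> nat \<Rightarrow> nat" where
  "hat l \<nu> = (\<lambda>i\<in>{1..2 * l}. \<nu> (2 * l + 1 - i))"

definition sibirsky_ideal ::
    "nat \<Rightarrow> (nat \<Rightarrow> int) \<Rightarrow> (nat \<Rightarrow> nat) \<Rightarrow> (nat, 'k::field) mpoly set" where
  "sibirsky_ideal l p q =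
     Idl\<^bsub>mpoly_ring {1..2 * l}\<^esub>
       {coeff_monomial l \<nu> - coeff_monomial l (hat l \<nu>) | \<nu>. \<nu> \<in> sibirsky_monoid l p q}"

end

theory Submission
  imports Defs "HOL-Computational_Algebra.Polynomial"
begin

text \<open>
  Writing time-reversibility as \<open>b\<^bsub>qp\<^esub> = \<gamma>\<^bsup>p - q\<^esup> a\<^bsub>pq\<^esub>\<close>, the reversible systems with nonzero
  coefficients form the image of a torus with coordinates \<open>\<gamma>\<close> and \<open>a\<^bsub>pq\<^esub>\<close>, on which every monomial
  restricts to a character. If a polynomial vanishes on this image, then by independence of characters
  its coefficients sum to zero over each class of monomials with the same character. As the field is
  infinite, two monomials in the same class have equal exponents in \<open>\<gamma>\<close> and in each \<open>a\<^bsub>pq\<^esub>\<close>, hence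
  they differ by a multiple of a generator of the Sibirsky ideal and take the same value at every
  point of its variety. So the polynomial vanishes on this variety.
\<close>

section \<open>Evaluation of polynomials\<close>

definition monom_subst :: "('v \<Rightarrow> 'r::comm_semiring_1) \<Rightarrow> ('v \<Rightarrow>\<^sub>0 nat) \<Rightarrow> 'r" where
  "monom_subst x m = (\<Prod>v\<in>Poly_Mapping.keys m. x v ^ Poly_Mapping.lookup m v)"

lemma monom_subst_superset:
  assumes "finite A" "Poly_Mapping.keys m \<subseteq> A"
  shows "monom_subst x m = (\<Prod>v\<in>A. x v ^ Poly_Mapping.lookup m v)"
  unfolding monom_subst_def using assms
  by (intro prod.mono_neutral_left) (auto simp: in_keys_iff)

lemma monom_subst_add: "monom_subst x (m + n) = monom_subst x m * monom_subst x n"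
proof -
  let ?A = "Poly_Mapping.keys m \<union> Poly_Mapping.keys n"
  have "monom_subst x k = (\<Prod>v\<in>?A. x v ^ Poly_Mapping.lookup k v)" if "k \<in> {m, n, m + n}" for k
    using that Poly_Mapping.keys_add[of m n] by (intro monom_subst_superset) auto
  then show ?thesis
    by (simp add: lookup_add power_add prod.distrib)
qed

lemma monom_subst_single [simp]: "monom_subst x (Poly_Mapping.single v n) = x v ^ n"
  by (simp add: monom_subst_def)

lemma msubst_altdef:
  "msubst \<phi> x f =
     (\<Sum>m\<in>Poly_Mapping.keys f. \<phi> (Poly_Mapping.lookup f m) * monom_subst x m)"
  by (simp add: msubst_def monom_subst_def)

lemma poly_mapping_sum_single:
  "f = (\<Sum>m\<in>Poly_Mapping.keys f. Poly_Mapping.single m (Poly_Mapping.lookup f m))"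
proof (rule poly_mapping_eqI)
  fix k
  have "(\<Sum>m\<in>Poly_Mapping.keys f. if m = k then Poly_Mapping.lookup f m else 0) = Poly_Mapping.lookup f k"
    by (simp add: sum.delta in_keys_iff)
  then show "Poly_Mapping.lookup f k = Poly_Mapping.lookup
      (\<Sum>m\<in>Poly_Mapping.keys f. Poly_Mapping.single m (Poly_Mapping.lookup f m)) k"
    by (simp add: lookup_sum lookup_single when_def)
qed

text \<open>Two instances are needed: \<open>id\<close> for the value at a point and
  \<open>mconst\<close> for substituting polynomials. In both, \<open>\<phi>\<close> being a ring
  homomorphism makes \<open>msubst \<phi> x\<close> one too.\<close>

locale coeff_hom =
  fixes \<phi> :: "'k::comm_ring_1 \<Rightarrow> 'r::comm_ring_1"
  assumes zero: "\<phi> 0 = 0" and one: "\<phi> 1 = 1"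
    and add: "\<phi> (a + b) = \<phi> a + \<phi> b" and mult: "\<phi> (a * b) = \<phi> a * \<phi> b"
begin

lemma msubst_single: "msubst \<phi> x (Poly_Mapping.single m c) = \<phi> c * monom_subst x m"
  by (cases "c = 0") (simp_all add: msubst_altdef zero)

lemma msubst_zero: "msubst \<phi> x 0 = 0"
  by (simp add: msubst_def)

lemma msubst_one: "msubst \<phi> x 1 = 1"
  using msubst_single[of x 0 1] by (simp add: one monom_subst_def)

lemma msubst_add: "msubst \<phi> x (f + g) = msubst \<phi> x f + msubst \<phi> x g"
  unfolding msubst_altdef
  by (rule setsum_keys_plus_distrib) (simp_all add: zero add distrib_right)

lemma msubst_uminus: "msubst \<phi> x (- f) = - msubst \<phi> x f"
  using msubst_add[of x f "- f"] by (simp add: msubst_zero eq_neg_iff_add_eq_0 add.commute)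

lemma msubst_diff: "msubst \<phi> x (f - g) = msubst \<phi> x f - msubst \<phi> x g"
  using msubst_add[of x f "- g"] by (simp add: msubst_uminus)

lemma msubst_sum: "msubst \<phi> x (\<Sum>i\<in>A. F i) = (\<Sum>i\<in>A. msubst \<phi> x (F i))"
  by (induction A rule: infinite_finite_induct) (simp_all add: msubst_zero msubst_add)

text \<open>Both factors are expanded into single terms; for these the claim is multiplicativity of
  \<open>\<phi>\<close> and \<open>monom_subst_add\<close>.\<close>

lemma msubst_mult: "msubst \<phi> x (f * g) = msubst \<phi> x f * msubst \<phi> x g"
proof -
  have "f * g = (\<Sum>m\<in>Poly_Mapping.keys f. \<Sum>n\<in>Poly_Mapping.keys g.
      Poly_Mapping.single (m + n) (Poly_Mapping.lookup f m * Poly_Mapping.lookup g n))"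
    using arg_cong2[OF poly_mapping_sum_single[of f] poly_mapping_sum_single[of g], of "(*)"]
    by (simp only: sum_product mult_single)
  then have "msubst \<phi> x (f * g) = (\<Sum>m\<in>Poly_Mapping.keys f. \<Sum>n\<in>Poly_Mapping.keys g.
      (\<phi> (Poly_Mapping.lookup f m) * monom_subst x m) *
      (\<phi> (Poly_Mapping.lookup g n) * monom_subst x n))"
    by (simp add: msubst_sum msubst_single mult monom_subst_add mult_ac)
  then show ?thesis
    by (simp add: msubst_altdef sum_product)
qed

lemma msubst_power: "msubst \<phi> x (f ^ n) = msubst \<phi> x f ^ n"
  by (induction n) (simp_all add: msubst_one msubst_mult)

lemma msubst_prod: "msubst \<phi> x (\<Prod>i\<in>A. F i) = (\<Prod>i\<in>A. msubst \<phi> x (F i))"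
  by (induction A rule: infinite_finite_induct) (simp_all add: msubst_one msubst_mult)

lemma msubst_mvar: "msubst \<phi> x (mvar v) = x v"
  by (simp add: mvar_def msubst_single one)

end

interpretation eval: coeff_hom "id :: 'k::comm_ring_1 \<Rightarrow> 'k"
  by unfold_locales simp_all

interpretation mconst: coeff_hom "mconst :: 'k::comm_ring_1 \<Rightarrow> ('v, 'k) mpoly"
  by unfold_locales (simp_all add: mconst_def single_add mult_single)

lemma mconst_power: "mconst c ^ n = mconst (c ^ n :: 'k::comm_ring_1)"
  by (induction n) (simp_all add: mconst.one mconst.mult)

lemma mvar_power: "(mvar v :: ('v, 'k::comm_ring_1) mpoly) ^ n =
    Poly_Mapping.single (Poly_Mapping.single v n) 1"
  by (induction n) (simp_all add: mvar_def mult_single flip: single_add)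

lemma msubst_coeff_monomial: "msubst id c (coeff_monomial l \<nu>) = (\<Prod>i=1..2 * l. c i ^ \<nu> i)"
  by (simp add: coeff_monomial_def eval.msubst_prod eval.msubst_power eval.msubst_mvar)

section \<open>Ideals and their zero sets\<close>

lemma coeff_monomial_closed: "coeff_monomial l \<nu> \<in> carrier (mpoly_ring {1..2 * l})"
proof -
  interpret cring "mpoly_ring {1..2 * l} :: (nat, 'a) mpoly ring"
    by (rule cring_mpoly_ring)
  have "(\<Prod>i\<in>A. mvar i ^ \<nu> i) \<in> carrier (mpoly_ring {1..2 * l} :: (nat, 'a) mpoly ring)"
    if "finite A" "A \<subseteq> {1..2 * l}" for A
    using that
  proof (induction A rule: finite_induct)
    case empty
    then show ?case
      using one_closed by (simp add: mpoly_ring_def)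
  next
    case (insert i A)
    have "mvar i ^ \<nu> i \<in> carrier (mpoly_ring {1..2 * l} :: (nat, 'a) mpoly ring)"
      using insert.prems by (auto simp: mvar_power mpoly_ring_def vars_def)
    from m_closed[OF this insert.IH] show ?case
      using insert by (simp add: mpoly_ring_def)
  qed
  then show ?thesis
    by (simp add: coeff_monomial_def)
qed

lemma mpoly_ring_diff_closed:
  fixes f g :: "('v, 'k::comm_ring_1) mpoly"
  assumes "f \<in> carrier (mpoly_ring X)" "g \<in> carrier (mpoly_ring X)"
  shows "f - g \<in> carrier (mpoly_ring X)"
  using assms Poly_Mapping.keys_diff[of f g] unfolding mpoly_ring_def vars_def
  by (simp only: partial_object.simps mem_Collect_eq) blast

text \<open>Serves to pass from generators to the ideal they generate, by minimality of the
  latter.\<close>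

lemma ideal_vanishing_at:
  "ideal {f \<in> carrier (mpoly_ring X). msubst id c f = 0} (mpoly_ring X :: ('v, 'k::comm_ring_1) mpoly ring)"
    (is "ideal ?I ?R")
proof -
  interpret cring ?R
    by (rule cring_mpoly_ring)
  have minus: "\<ominus>\<^bsub>?R\<^esub> f = - f" if "f \<in> carrier ?R" for f
    using that by (intro minus_equality) (auto simp: mpoly_ring_def vars_def)
  have ops: "f \<oplus>\<^bsub>?R\<^esub> g = f + g" "f \<otimes>\<^bsub>?R\<^esub> g = f * g" "\<zero>\<^bsub>?R\<^esub> = 0" for f g
    by (simp_all add: mpoly_ring_def)
  show ?thesis
  proof (rule idealI)
    show "subgroup ?I (add_monoid ?R)"
    proof (rule add.subgroupI)
      show "?I \<noteq> {}"
        using zero_closed eval.msubst_zero by (fastforce simp: ops)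
      show "\<ominus>\<^bsub>?R\<^esub> f \<in> ?I" if "f \<in> ?I" for f
        using that a_inv_closed[of f] minus[of f] by (simp add: eval.msubst_uminus)
      show "f \<oplus>\<^bsub>?R\<^esub> g \<in> ?I" if "f \<in> ?I" "g \<in> ?I" for f g
        using that a_closed[of f g] by (simp add: ops eval.msubst_add)
    qed auto
  next
    fix f g assume "f \<in> ?I" "g \<in> carrier ?R"
    then show "g \<otimes>\<^bsub>?R\<^esub> f \<in> ?I" "f \<otimes>\<^bsub>?R\<^esub> g \<in> ?I"
      using m_closed[of f g] m_closed[of g f] by (simp_all add: ops eval.msubst_mult)
  qed (rule ring_axioms)
qed

text \<open>If the generators vanish at \<open>c\<close>, the ideal of all polynomials vanishing at
  \<open>c\<close> contains them and hence contains the generated ideal.\<close>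

lemma zero_set_genideal:
  fixes F :: "(nat, 'k::comm_ring_1) mpoly set"
  assumes "F \<subseteq> carrier (mpoly_ring {1..n})"
  shows "zero_set n (Idl\<^bsub>mpoly_ring {1..n}\<^esub> F) = zero_set n F"
proof -
  interpret cring "mpoly_ring {1..n} :: (nat, 'k) mpoly ring"
    by (rule cring_mpoly_ring)
  have "msubst id c f = 0"
    if "\<forall>f\<in>F. msubst id c f = 0" "f \<in> Idl\<^bsub>mpoly_ring {1..n}\<^esub> F" for c f
    using genideal_minimal[OF ideal_vanishing_at[of "{1..n}" c], of F] that assms by auto
  then show ?thesis
    using genideal_self[OF assms] by (auto simp only: zero_set_def)
qed

lemma binomials_in_carrier:
  "{coeff_monomial l \<nu> - coeff_monomial l (hat l \<nu>) | \<nu>. \<nu> \<in> sibirsky_monoid l p q}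
     \<subseteq> carrier (mpoly_ring {1..2 * l})"
  by (intro subsetI; elim CollectE exE conjE; simp only: mpoly_ring_diff_closed coeff_monomial_closed)

lemma ideal_sibirsky_ideal: "ideal (sibirsky_ideal l p q) (mpoly_ring {1..2 * l})"
  unfolding sibirsky_ideal_def
  by (rule ring.genideal_ideal[OF cring.axioms(1)[OF cring_mpoly_ring] binomials_in_carrier])

lemma zero_set_sibirsky_ideal:
  "zero_set (2 * l) (sibirsky_ideal l p q) =
     {c \<in> affine_space (2 * l). \<forall>\<nu>\<in>sibirsky_monoid l p q.
        (\<Prod>i=1..2 * l. c i ^ \<nu> i) = (\<Prod>i=1..2 * l. c i ^ hat l \<nu> i)}"
  unfolding sibirsky_ideal_def zero_set_genideal[OF binomials_in_carrier]
  by (auto simp: zero_set_def eval.msubst_diff msubst_coeff_monomial)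

section \<open>Time-reversibility in terms of the coefficients\<close>

text \<open>As \<open>g\<close> is injective, no two summands share an exponent, so the coefficient
  at \<open>g j\<close> is that of the summand \<open>j\<close> alone.\<close>

lemma sum_single_eq_iff:
  assumes "finite A" "inj_on g A"
  shows "(\<Sum>j\<in>A. Poly_Mapping.single (g j) (a j)) = (\<Sum>j\<in>A. Poly_Mapping.single (g j) (b j)) \<longleftrightarrow>
    (\<forall>j\<in>A. a j = b j)"
proof -
  have "Poly_Mapping.lookup (\<Sum>i\<in>A. Poly_Mapping.single (g i) (c i)) (g j) = c j" if "j \<in> A" for c j
  proof -
    have "Poly_Mapping.lookup (\<Sum>i\<in>A. Poly_Mapping.single (g i) (c i)) (g j) =
        (\<Sum>i\<in>A. if i = j then c i else 0)"
      unfolding lookup_sum using that inj_onD[OF assms(2)]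
      by (intro sum.cong) (auto simp: lookup_single when_def)
    then show ?thesis
      using assms(1) that by (simp add: sum.delta)
  qed
  then show ?thesis
    by (metis (no_types, lifting) sum.cong)
qed

definition xy_exp :: "nat \<Rightarrow> nat \<Rightarrow> xy \<Rightarrow>\<^sub>0 nat" where
  "xy_exp i j = Poly_Mapping.single VarX i + Poly_Mapping.single VarY j"

lemma xy_exp_eq_iff: "xy_exp i j = xy_exp i' j' \<longleftrightarrow> i = i' \<and> j = j'"
proof -
  have "Poly_Mapping.lookup (xy_exp i j) VarX = i" "Poly_Mapping.lookup (xy_exp i j) VarY = j" for i j
    by (simp_all add: xy_exp_def lookup_add lookup_single)
  then show ?thesis
    by metis
qed

lemma xy_monomial:
  "mconst c * mvar VarX ^ i * mvar VarY ^ j = Poly_Mapping.single (xy_exp i j) (c :: 'k::comm_ring_1)"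
  by (simp add: mvar_power mconst_def mult_single xy_exp_def)

lemma P_poly_altdef:
  "P_poly l p q c = - (\<Sum>j=1..l. Poly_Mapping.single (xy_exp (nat (p j + 1)) (q j)) (c j))"
  by (simp add: P_poly_def xy_monomial)

lemma Q_poly_altdef:
  "Q_poly l p q c =
     (\<Sum>j=1..l. Poly_Mapping.single (xy_exp (q j) (nat (p j + 1))) (c (2 * l + 1 - j)))"
  by (simp add: Q_poly_def xy_monomial)

lemma swap_subst_uminus: "swap_subst \<gamma> (- f) = - swap_subst \<gamma> f"
  by (simp add: swap_subst_def mconst.msubst_uminus)

lemma swap_subst_sum_single:
  "swap_subst \<gamma> (\<Sum>a\<in>A. Poly_Mapping.single (xy_exp (i a) (j a)) (c a)) =
     (\<Sum>a\<in>A. Poly_Mapping.single (xy_exp (j a) (i a)) (c a * \<gamma> ^ i a * (1 / \<gamma>) ^ j a))"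
proof -
  have "swap_subst \<gamma> (Poly_Mapping.single (xy_exp i j) c) =
      mconst c * (mconst \<gamma> * mvar VarY) ^ i * (mconst (1 / \<gamma>) * mvar VarX) ^ j" for i j c
    by (simp add: swap_subst_def mconst.msubst_single xy_exp_def monom_subst_add mult.assoc)
  also have "\<dots> i j c = mconst (c * \<gamma> ^ i * (1 / \<gamma>) ^ j) * mvar VarX ^ j * mvar VarY ^ i" for i j c
    by (simp add: power_mult_distrib mconst_power mconst.mult mult_ac)
  finally show ?thesis
    by (simp add: xy_monomial) (simp add: swap_subst_def mconst.msubst_sum)
qed

lemma mconst_mult_sum_single:
  "mconst \<gamma> * (\<Sum>a\<in>A. Poly_Mapping.single (g a) (c a)) =
     (\<Sum>a\<in>A. Poly_Mapping.single (g a) (\<gamma> * c a))"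
  by (simp add: sum_distrib_left mconst_def mult_single)

text \<open>Comparing coefficients in either polynomial identity gives the same condition on
  \<open>\<gamma>\<close>. Distinctness of the pairs keeps the monomials of the system distinct, and
  \<open>p j \<ge> -1\<close> ensures that \<open>nat (p j + 1)\<close> determines
  \<open>p j\<close>.\<close>

lemma time_reversible_iff:
  fixes c :: "nat \<Rightarrow> 'k::field"
  assumes inj: "inj_on (\<lambda>j. (p j, q j)) {1..l}"
    and p: "\<And>j. j \<in> {1..l} \<Longrightarrow> p j \<ge> -1"
  shows "time_reversible l p q c \<longleftrightarrow>
    (\<exists>\<gamma>. \<gamma> \<noteq> 0 \<and> (\<forall>j\<in>{1..l}. c (2 * l + 1 - j) = \<gamma> powi (p j - int (q j)) * c j))"
proof -
  have "j = j'" if "j \<in> {1..l}" "j' \<in> {1..l}" "q j = q j'" "nat (p j + 1) = nat (p j' + 1)" for j j'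
  proof -
    have "p j = p j'"
      using that p[of j] p[of j'] by linarith
    then show ?thesis
      using inj_onD[OF inj, of j j'] that by simp
  qed
  then have inj1: "inj_on (\<lambda>j. xy_exp (nat (p j + 1)) (q j)) {1..l}"
    and inj2: "inj_on (\<lambda>j. xy_exp (q j) (nat (p j + 1))) {1..l}"
    by (auto simp: inj_on_def xy_exp_eq_iff)
  \<comment> \<open>The numerator exponent is the shifted \<open>p j + 1\<close> occurring in the
    system; the extra \<open>\<gamma>\<close> in the denominator is the factor
    \<open>mconst \<gamma>\<close> of both identities.\<close>
  have powi: "\<gamma> powi (p j - int (q j)) = \<gamma> ^ nat (p j + 1) / (\<gamma> ^ q j * \<gamma>)"
    if "\<gamma> \<noteq> 0" "j \<in> {1..l}" for \<gamma> :: 'k and j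
  proof -
    have "\<gamma> powi (p j - int (q j)) = \<gamma> powi (int (nat (p j + 1)) - int (q j + 1))"
      using p[OF that(2)] by (intro arg_cong[of _ _ "power_int \<gamma>"]) simp
    also have "\<dots> = \<gamma> ^ nat (p j + 1) / \<gamma> ^ (q j + 1)"
      using that(1) by (simp only: power_int_diff power_int_of_nat simp_thms)
    finally show ?thesis
      by (simp add: mult.commute)
  qed
  have "mconst \<gamma> * swap_subst \<gamma> (Q_poly l p q c) = - P_poly l p q c \<longleftrightarrow>
      (\<forall>j\<in>{1..l}. c (2 * l + 1 - j) = \<gamma> powi (p j - int (q j)) * c j)"
    "mconst \<gamma> * Q_poly l p q c = - swap_subst \<gamma> (P_poly l p q c) \<longleftrightarrow>
      (\<forall>j\<in>{1..l}. c (2 * l + 1 - j) = \<gamma> powi (p j - int (q j)) * c j)"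
    if "\<gamma> \<noteq> 0" for \<gamma>
    unfolding P_poly_altdef Q_poly_altdef swap_subst_uminus swap_subst_sum_single
      mconst_mult_sum_single minus_minus
      sum_single_eq_iff[OF finite_atLeastAtMost inj1] sum_single_eq_iff[OF finite_atLeastAtMost inj2]
    using that by (intro ball_cong refl; simp add: powi field_simps; fail)+
  then show ?thesis
    unfolding time_reversible_def by blast
qed

section \<open>Independence of characters\<close>

text \<open>Artin's argument by induction on \<open>C\<close>: a relation is shortened by
  eliminating one character \<open>\<psi>\<close>, and the induction hypothesis applies to the
  shorter one.\<close>

lemma characters_independent:
  fixes C :: "('g \<Rightarrow> 'k::field) set" and mult :: "'g \<Rightarrow> 'g \<Rightarrow> 'g"
  assumes "finite C"
    and mult_closed: "\<And>x y. x \<in> G \<Longrightarrow> y \<in> G \<Longrightarrow> mult x y \<in> G"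
    and "\<And>\<chi> x y. \<chi> \<in> C \<Longrightarrow> x \<in> G \<Longrightarrow> y \<in> G \<Longrightarrow> \<chi> (mult x y) = \<chi> x * \<chi> y"
    and "\<And>\<chi>. \<chi> \<in> C \<Longrightarrow> \<exists>x\<in>G. \<chi> x \<noteq> 0"
    and "\<And>\<chi> \<psi>. \<chi> \<in> C \<Longrightarrow> \<psi> \<in> C \<Longrightarrow> \<chi> \<noteq> \<psi> \<Longrightarrow> \<exists>x\<in>G. \<chi> x \<noteq> \<psi> x"
    and "\<And>x. x \<in> G \<Longrightarrow> (\<Sum>\<chi>\<in>C. a \<chi> * \<chi> x) = 0"
    and "\<chi> \<in> C"
  shows "a \<chi> = 0"
  using assms(1,3-)
proof (induction C arbitrary: a \<chi> rule: finite_induct)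
  case (insert \<psi> C)
  have a_zero: "a \<chi> = 0" if \<chi>: "\<chi> \<in> C" for \<chi>
  proof -
    obtain y where y: "y \<in> G" "\<chi> y \<noteq> \<psi> y"
      using insert.prems(3)[of \<chi> \<psi>] insert.hyps(2) \<chi> by blast
    \<comment> \<open>The relation at \<open>mult x y\<close> minus \<open>\<psi> y\<close> times
      the relation at \<open>x\<close>: the term of \<open>\<psi>\<close> cancels.\<close>
    have "(\<Sum>\<chi>\<in>C. a \<chi> * (\<chi> y - \<psi> y) * \<chi> x) = 0" if x: "x \<in> G" for x
    proof -
      have "(\<Sum>\<chi>\<in>insert \<psi> C. a \<chi> * \<chi> (mult x y)) - \<psi> y * (\<Sum>\<chi>\<in>insert \<psi> C. a \<chi> * \<chi> x) = 0"
        using insert.prems(4)[OF x] insert.prems(4)[OF mult_closed[OF x y(1)]] by simp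
      also have "(\<Sum>\<chi>\<in>insert \<psi> C. a \<chi> * \<chi> (mult x y)) = (\<Sum>\<chi>\<in>insert \<psi> C. a \<chi> * (\<chi> x * \<chi> y))"
        using insert.prems(1) x y(1) by (intro sum.cong) auto
      finally show ?thesis
        using insert.hyps by (simp add: algebra_simps sum_distrib_left sum_subtractf)
    qed
    then have "a \<chi> * (\<chi> y - \<psi> y) = 0"
      using insert.prems(1-3) by (intro insert.IH[of "\<lambda>\<chi>. a \<chi> * (\<chi> y - \<psi> y)"] \<chi>) auto
    then show ?thesis
      using y(2) by simp
  qed
  obtain x where x: "x \<in> G" "\<psi> x \<noteq> 0"
    using insert.prems(2)[of \<psi>] by blast
  have "(\<Sum>\<chi>\<in>C. a \<chi> * \<chi> x) = 0"
    using a_zero by (intro sum.neutral) simp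
  then have "a \<psi> * \<psi> x = 0"
    using insert.prems(4)[OF x(1)] insert.hyps by simp
  then show ?case
    using x(2) a_zero insert.prems(5) by auto
qed simp

text \<open>Otherwise every nonzero field element would be a root of \<open>monom 1 n - 1\<close>,
  where \<open>n > 0\<close> is the gap between the exponents, and the field would be
  finite.\<close>

lemma powi_eq_imp_exponent_eq:
  assumes "infinite (UNIV :: 'k::field set)"
    and "\<And>t :: 'k. t \<noteq> 0 \<Longrightarrow> t powi a = t powi b"
  shows "a = b"
proof -
  have False if ab: "a < b" "\<And>t :: 'k. t \<noteq> 0 \<Longrightarrow> t powi a = t powi b" for a b :: int
  proof -
    define n where "n = nat (b - a)"
    have n: "n > 0" "b - a = int n"
      using ab(1) by (simp_all add: n_def)
    have "t ^ n = 1" if "t \<noteq> 0" for t :: 'k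
      using ab(2)[OF that] power_int_diff[of t b a] that by (simp add: n(2))
    then have "t \<in> insert 0 {t. poly (monom 1 n - 1) t = 0}" for t :: 'k
      by (auto simp: poly_monom)
    moreover have "monom 1 n - 1 \<noteq> (0 :: 'k poly)"
    proof
      assume "monom 1 n - 1 = (0 :: 'k poly)"
      then have "coeff (monom 1 n - 1 :: 'k poly) n = 0"
        by simp
      then show False
        using n(1) by (simp add: coeff_1)
    qed
    ultimately show False
      using assms(1) poly_roots_finite finite_subset[of UNIV] by (metis finite_insert subsetI)
  qed
  from this[of a b] this[of b a] show ?thesis
    using assms(2) by (metis linorder_neqE)
qed

section \<open>A torus of time-reversible systems\<close>

text \<open>
  The systems satisfying \<open>b\<^bsub>qp\<^esub> = \<gamma>\<^bsup>p - q\<^esup> a\<^bsub>pq\<^esub>\<close> are parametrized by \<open>\<gamma>\<close> (the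
  coordinate \<open>x 0\<close>) and the coefficients \<open>a\<^bsub>pq\<^esub>\<close> (the coordinates \<open>x 1, \<dots>, x l\<close>).
\<close>

definition torus_exp :: "nat \<Rightarrow> (nat \<Rightarrow> int) \<Rightarrow> (nat \<Rightarrow> nat) \<Rightarrow> nat \<Rightarrow> int" where
  "torus_exp l p q i = (if i \<le> l then 0 else - zeta l p q i)"

definition torus_point ::
    "nat \<Rightarrow> (nat \<Rightarrow> int) \<Rightarrow> (nat \<Rightarrow> nat) \<Rightarrow> (nat \<Rightarrow> 'k::field) \<Rightarrow> nat \<Rightarrow> 'k" where
  "torus_point l p q x =
     (\<lambda>i\<in>{1..2 * l}. x 0 powi torus_exp l p q i * x (if i \<le> l then i else 2 * l + 1 - i))"

text \<open>Reflection of indices exchanges the two halves, and \<open>torus_exp\<close> vanishes on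
  the first. This expresses the \<open>zeta\<close>-weight of \<open>\<nu>\<close> as the degree in
  \<open>\<gamma>\<close> of the monomial of \<open>hat l \<nu>\<close> minus that of
  \<open>\<nu>\<close>.\<close>

lemma zeta_eq_torus_exp_diff:
  assumes "i \<in> {1..2 * l}"
  shows "zeta l p q i = torus_exp l p q (2 * l + 1 - i) - torus_exp l p q i"
  using assms by (auto simp: torus_exp_def zeta_def)

lemma sum_reflect: "(\<Sum>i=1..2 * l. f (2 * l + 1 - i)) = (\<Sum>i=1..2 * l. f i)"
  for f :: "nat \<Rightarrow> 'a::comm_monoid_add"
  by (subst (2) sum.atLeastAtMost_rev) (simp add: add.commute)

lemma prod_reflect: "(\<Prod>i=1..2 * l. f (2 * l + 1 - i)) = (\<Prod>i=1..2 * l. f i)"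
  for f :: "nat \<Rightarrow> 'a::comm_monoid_mult"
  by (subst (2) prod.atLeastAtMost_rev) (simp add: add.commute)

section \<open>Time-reversible systems satisfy the binomial equations\<close>

lemma prod_powi_power:
  fixes t :: "'k::field"
  assumes "t \<noteq> 0"
  shows "(\<Prod>i\<in>A. (t powi e i) ^ n i) = t powi (\<Sum>i\<in>A. e i * int (n i))"
  using assms
  by (induction A rule: infinite_finite_induct)
     (simp_all add: power_int_add power_int_mult)

text \<open>Reflecting the coordinates of \<open>c\<close> multiplies the \<open>i\<close>-th one by
  \<open>\<gamma>\<close> to the power \<open>zeta l p q i\<close>. The two monomials thus differ by
  a power of \<open>\<gamma>\<close> whose exponent is zero by the definition of the monoid.\<close>

lemma time_reversible_imp_binomial:
  fixes c :: "nat \<Rightarrow> 'k::field"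
  assumes "\<gamma> \<noteq> 0" and rev: "\<forall>j\<in>{1..l}. c (2 * l + 1 - j) = \<gamma> powi (p j - int (q j)) * c j"
    and \<nu>: "\<nu> \<in> sibirsky_monoid l p q"
  shows "(\<Prod>i=1..2 * l. c i ^ \<nu> i) = (\<Prod>i=1..2 * l. c i ^ hat l \<nu> i)"
proof -
  have c: "c (2 * l + 1 - i) = \<gamma> powi zeta l p q i * c i" if i: "i \<in> {1..2 * l}" for i
  proof (cases "i \<le> l")
    case True
    then show ?thesis
      using rev i by (simp add: zeta_def)
  next
    case False
    define j where "j = 2 * l + 1 - i"
    have j: "j \<in> {1..l}" "i = 2 * l + 1 - j"
      using False i by (auto simp: j_def)
    \<comment> \<open>In the second half \<open>zeta\<close> has the opposite sign, so the factor
      inverts that of the given relation.\<close>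
    have "\<gamma> powi zeta l p q i * \<gamma> powi (p j - int (q j)) = 1"
      using False assms(1) by (simp add: zeta_def j_def flip: power_int_add)
    moreover have "c i = \<gamma> powi (p j - int (q j)) * c j"
      using rev j by simp
    ultimately show ?thesis
      by (simp add: j_def flip: mult.assoc)
  qed
  have "(\<Prod>i=1..2 * l. c i ^ hat l \<nu> i) = (\<Prod>i=1..2 * l. c i ^ \<nu> (2 * l + 1 - i))"
    by (intro prod.cong) (auto simp: hat_def)
  also have "\<dots> = (\<Prod>i=1..2 * l. c (2 * l + 1 - i) ^ \<nu> i)"
    by (subst prod_reflect[symmetric]) (intro prod.cong, auto)
  also have "\<dots> = (\<Prod>i=1..2 * l. (\<gamma> powi zeta l p q i) ^ \<nu> i) * (\<Prod>i=1..2 * l. c i ^ \<nu> i)"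
    unfolding prod.distrib[symmetric] using c by (intro prod.cong) (auto simp: power_mult_distrib)
  also have "(\<Prod>i=1..2 * l. (\<gamma> powi zeta l p q i) ^ \<nu> i) = 1"
    using \<nu> by (simp add: prod_powi_power[OF assms(1)] sibirsky_monoid_def)
  finally show ?thesis
    by simp
qed

section \<open>Points and characters of the torus\<close>

lemma torus_point_time_reversible:
  fixes x :: "nat \<Rightarrow> 'k::field"
  assumes "inj_on (\<lambda>j. (p j, q j)) {1..l}" "\<And>j. j \<in> {1..l} \<Longrightarrow> p j \<ge> -1" and "x 0 \<noteq> 0"
  shows "torus_point l p q x \<in> time_reversible_systems l p q"
proof -
  have "torus_point l p q x (2 * l + 1 - j) = x 0 powi (p j - int (q j)) * torus_point l p q x j"
    if "j \<in> {1..l}" for j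
    using that by (auto simp: torus_point_def torus_exp_def zeta_def)
  then have "time_reversible l p q (torus_point l p q x)"
    using assms(3) by (subst time_reversible_iff[OF assms(1,2)]) auto
  then show ?thesis
    by (simp add: time_reversible_systems_def affine_space_def torus_point_def)
qed

lemma torus_point_mult:
  assumes "i \<in> {1..2 * l}"
  shows "torus_point l p q (\<lambda>i. x i * y i) i = torus_point l p q x i * torus_point l p q y i"
  using assms by (simp add: torus_point_def power_int_mult_distrib mult_ac)

text \<open>Restricting the function to the torus makes equality of characters mean equality on the
  torus, so that monomials can be sorted by their character.\<close>

definition torus_char ::
    "nat \<Rightarrow> (nat \<Rightarrow> int) \<Rightarrow> (nat \<Rightarrow> nat) \<Rightarrow> (nat \<Rightarrow> nat) \<Rightarrow> (nat \<Rightarrow> 'k::field) \<Rightarrow> 'k" where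
  "torus_char l p q m =
     (\<lambda>x\<in>{x. \<forall>i. x i \<noteq> 0}. \<Prod>i=1..2 * l. torus_point l p q x i ^ m i)"

text \<open>Both conclusions come from one-parameter subgroups: all coordinates are 1 except one,
  which is \<open>t\<close>. Coordinate \<open>i\<close> in \<open>{1..l}\<close> reads off the
  exponent of the \<open>i\<close>-th coefficient, coordinate 0 that of
  \<open>\<gamma>\<close>.\<close>

lemma torus_char_eq_imp:
  assumes inf: "infinite (UNIV :: 'k::field set)"
    and eq: "(torus_char l p q m :: (nat \<Rightarrow> 'k) \<Rightarrow> 'k) = torus_char l p q m'"
  shows "\<And>i. i \<in> {1..2 * l} \<Longrightarrow> m i + m (2 * l + 1 - i) = m' i + m' (2 * l + 1 - i)"
    and "(\<Sum>i=1..2 * l. torus_exp l p q i * int (m i)) = (\<Sum>i=1..2 * l. torus_exp l p q i * int (m' i))"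
proof -
  have eq_at: "(\<Prod>i=1..2 * l. torus_point l p q x i ^ m i) = (\<Prod>i=1..2 * l. torus_point l p q x i ^ m' i)"
    if "\<And>i. x i \<noteq> 0" for x :: "nat \<Rightarrow> 'k"
    using fun_cong[OF eq, of x] that by (simp add: torus_char_def)
  have half: "m i + m (2 * l + 1 - i) = m' i + m' (2 * l + 1 - i)" if i: "i \<in> {1..l}" for i
  proof -
    have "t powi int (m i + m (2 * l + 1 - i)) = t powi int (m' i + m' (2 * l + 1 - i))"
      if t: "t \<noteq> 0" for t :: 'k
    proof -
      have "(\<Prod>j=1..2 * l. torus_point l p q ((\<lambda>_. 1)(i := t)) j ^ n j) = t ^ (n i + n (2 * l + 1 - i))"
        for n :: "nat \<Rightarrow> nat"
      proof -
        \<comment> \<open>Since \<open>i \<ge> 1\<close>, the parameter \<open>\<gamma>\<close> is 1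
          here, and only the coordinates \<open>i\<close> and \<open>2 * l + 1 - i\<close> of the
          point involve \<open>t\<close>.\<close>
        have "(\<Prod>j=1..2 * l. torus_point l p q ((\<lambda>_. 1)(i := t)) j ^ n j) =
            (\<Prod>j\<in>{i, 2 * l + 1 - i}. t ^ n j)"
          using i by (intro prod.mono_neutral_cong_right) (auto simp: torus_point_def)
        also have "\<dots> = t ^ (n i + n (2 * l + 1 - i))"
        proof -
          have "i \<noteq> 2 * l + 1 - i"
            using i by auto
          then show ?thesis
            by (simp add: power_add)
        qed
        finally show ?thesis .
      qed
      then show ?thesis
        using eq_at[of "(\<lambda>_. 1)(i := t)"] t by (simp del: of_nat_add)
    qed
    from powi_eq_imp_exponent_eq[OF inf this] show ?thesis
      by linarith
  qed
  show "m i + m (2 * l + 1 - i) = m' i + m' (2 * l + 1 - i)" if "i \<in> {1..2 * l}" for i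
  proof (cases "i \<le> l")
    case False
    then have "2 * l + 1 - i \<in> {1..l}" "2 * l + 1 - (2 * l + 1 - i) = i"
      using that by auto
    then show ?thesis
      using half[of "2 * l + 1 - i"] by (simp add: add.commute)
  qed (use half that in auto)
  have "t powi (\<Sum>i=1..2 * l. torus_exp l p q i * int (m i)) =
      t powi (\<Sum>i=1..2 * l. torus_exp l p q i * int (m' i))" if t: "t \<noteq> 0" for t :: 'k
  proof -
    have "(\<Prod>j=1..2 * l. torus_point l p q ((\<lambda>_. 1)(0 := t)) j ^ n j) =
        t powi (\<Sum>i=1..2 * l. torus_exp l p q i * int (n i))" for n :: "nat \<Rightarrow> nat"
      unfolding prod_powi_power[OF t, symmetric] by (intro prod.cong) (auto simp: torus_point_def)
    then show ?thesis
      using eq_at[of "(\<lambda>_. 1)(0 := t)"] t by simp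
  qed
  from powi_eq_imp_exponent_eq[OF inf this]
  show "(\<Sum>i=1..2 * l. torus_exp l p q i * int (m i)) = (\<Sum>i=1..2 * l. torus_exp l p q i * int (m' i))" .
qed

text \<open>
  Removing the greatest common divisor of two monomials with the same character leaves the monomials
  of \<open>\<nu>\<close> and \<open>hat l \<nu>\<close> for some \<open>\<nu>\<close> in the Sibirsky monoid. The exponents of these
  cofactors are the truncated differences \<open>m i - m' i\<close> and \<open>m' i - m i\<close>.
\<close>

lemma torus_char_eq_imp_monomial_eq:
  fixes c :: "nat \<Rightarrow> 'k::field"
  assumes inf: "infinite (UNIV :: 'k set)"
    and eq: "(torus_char l p q m :: (nat \<Rightarrow> 'k) \<Rightarrow> 'k) = torus_char l p q m'"
    and c: "\<And>\<nu>. \<nu> \<in> sibirsky_monoid l p q \<Longrightarrow>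
      (\<Prod>i=1..2 * l. c i ^ \<nu> i) = (\<Prod>i=1..2 * l. c i ^ hat l \<nu> i)"
  shows "(\<Prod>i=1..2 * l. c i ^ m i) = (\<Prod>i=1..2 * l. c i ^ m' i)"
proof -
  note sums = torus_char_eq_imp[OF inf eq]
  define \<nu> where "\<nu> = (\<lambda>i\<in>{1..2 * l}. m i - m' i)"
  \<comment> \<open>Equal sums over each reflected pair force the two differences in the pair to be
    opposite, also after truncation.\<close>
  have reflected: "m (2 * l + 1 - i) - m' (2 * l + 1 - i) = m' i - m i" if "i \<in> {1..2 * l}" for i
    using sums(1)[OF that] by linarith
  have hat: "hat l \<nu> i = m' i - m i" if "i \<in> {1..2 * l}" for i
    using reflected[OF that] that by (auto simp: hat_def \<nu>_def)
  let ?e = "torus_exp l p q"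
  have "(\<Sum>i=1..2 * l. zeta l p q i * int (\<nu> i)) =
      (\<Sum>i=1..2 * l. ?e (2 * l + 1 - i) * int (m i - m' i)) - (\<Sum>i=1..2 * l. ?e i * int (m i - m' i))"
    unfolding sum_subtractf[symmetric]
    by (intro sum.cong) (auto simp: zeta_eq_torus_exp_diff \<nu>_def left_diff_distrib)
  also have "(\<Sum>i=1..2 * l. ?e (2 * l + 1 - i) * int (m i - m' i)) = (\<Sum>i=1..2 * l. ?e i * int (m' i - m i))"
    by (subst sum_reflect[symmetric]) (intro sum.cong, auto simp: reflected[symmetric])
  \<comment> \<open>At most one of the two truncated differences is nonzero, so subtracting them
    recovers the integer \<open>m' i - m i\<close>.\<close>
  also have "\<dots> - (\<Sum>i=1..2 * l. ?e i * int (m i - m' i)) =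
      (\<Sum>i=1..2 * l. ?e i * int (m' i)) - (\<Sum>i=1..2 * l. ?e i * int (m i))"
    unfolding sum_subtractf[symmetric] right_diff_distrib[symmetric]
    by (intro sum.cong refl arg_cong2[of _ _ _ _ "(*)"]) auto
  also have "\<dots> = 0"
    using sums(2) by simp
  finally have "\<nu> \<in> sibirsky_monoid l p q"
    by (simp add: sibirsky_monoid_def \<nu>_def)
  from c[OF this] have "(\<Prod>i=1..2 * l. c i ^ (m i - m' i)) = (\<Prod>i=1..2 * l. c i ^ (m' i - m i))"
    using hat by (simp add: \<nu>_def)
  \<comment> \<open>The common divisor is multiplied back instead of cancelled, so coordinates of
    \<open>c\<close> may be zero.\<close>
  moreover have "(\<Prod>i=1..2 * l. c i ^ a i) =
      (\<Prod>i=1..2 * l. c i ^ min (a i) (b i)) * (\<Prod>i=1..2 * l. c i ^ (a i - b i))" for a b :: "nat \<Rightarrow> nat"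
    unfolding prod.distrib[symmetric] power_add[symmetric]
    by (intro prod.cong refl arg_cong2[of _ _ _ _ "(^)"]) simp
  from this[of m m'] this[of m' m] show ?thesis
    using calculation by (simp add: min.commute)
qed

text \<open>This is minimality of the variety in polynomial form: whatever vanishes on all
  time-reversible systems vanishes on the zero set of the Sibirsky ideal.\<close>

lemma vanishing_on_time_reversible_systems:
  fixes c :: "nat \<Rightarrow> 'k::field"
  assumes inf: "infinite (UNIV :: 'k set)"
    and inj: "inj_on (\<lambda>j. (p j, q j)) {1..l}" and p: "\<And>j. j \<in> {1..l} \<Longrightarrow> p j \<ge> -1"
    and f: "f \<in> carrier (mpoly_ring {1..2 * l})"
    and zero: "\<And>x :: nat \<Rightarrow> 'k. x \<in> time_reversible_systems l p q \<Longrightarrow> msubst id x f = 0"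
    and c: "c \<in> zero_set (2 * l) (sibirsky_ideal l p q)"
  shows "msubst id c f = 0"
proof -
  define G where "G = {x :: nat \<Rightarrow> 'k. \<forall>i. x i \<noteq> 0}"
  define K where "K = Poly_Mapping.keys f"
  define \<chi> where "\<chi> = (\<lambda>m. torus_char l p q (Poly_Mapping.lookup m) :: (nat \<Rightarrow> 'k) \<Rightarrow> 'k)"
  \<comment> \<open>Distinct monomials may induce the same character; \<open>coef \<psi>\<close> is
    the total coefficient of \<open>\<psi>\<close> when \<open>f\<close> is restricted to the
    torus.\<close>
  define coef where "coef = (\<lambda>\<psi>. \<Sum>m\<in>{m\<in>K. \<chi> m = \<psi>}. Poly_Mapping.lookup f m)"
  have [simp]: "finite K"
    by (simp add: K_def)
  have subst: "msubst id y f =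
      (\<Sum>m\<in>K. Poly_Mapping.lookup f m * (\<Prod>i=1..2 * l. y i ^ Poly_Mapping.lookup m i))" for y :: "nat \<Rightarrow> 'k"
    unfolding msubst_altdef K_def using f
    by (intro sum.cong refl arg_cong2[of _ _ _ _ "(*)"] monom_subst_superset)
       (auto simp: mpoly_ring_def vars_def)
  have \<chi>_apply: "\<chi> m x = (\<Prod>i=1..2 * l. torus_point l p q x i ^ Poly_Mapping.lookup m i)"
    if "x \<in> G" for m x
    using that by (simp add: \<chi>_def torus_char_def G_def)
  have coef_zero: "coef \<psi> = 0" if "\<psi> \<in> \<chi> ` K" for \<psi>
  proof (rule characters_independent[of "\<chi> ` K" G "\<lambda>x y i. x i * y i" coef])
    show "(\<lambda>i. x i * y i) \<in> G" if "x \<in> G" "y \<in> G" for x y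
      using that by (simp add: G_def)
    show "\<psi> (\<lambda>i. x i * y i) = \<psi> x * \<psi> y" if "\<psi> \<in> \<chi> ` K" "x \<in> G" "y \<in> G" for \<psi> x y
    proof -
      have "(\<lambda>i. x i * y i) \<in> G"
        using that by (simp add: G_def)
      then show ?thesis
        using that by (auto simp: \<chi>_apply torus_point_mult power_mult_distrib prod.distrib)
    qed
    show "\<exists>x\<in>G. \<psi> x \<noteq> 0" if "\<psi> \<in> \<chi> ` K" for \<psi>
    proof -
      have "(\<lambda>_. 1) \<in> G"
        by (simp add: G_def)
      moreover from this have "\<psi> (\<lambda>_. 1) = 1"
        using that by (auto simp: \<chi>_apply torus_point_def intro!: prod.neutral)
      ultimately show ?thesis
        by force
    qed
    show "\<exists>x\<in>G. \<psi> x \<noteq> \<psi>' x" if "\<psi> \<in> \<chi> ` K" "\<psi>' \<in> \<chi> ` K" "\<psi> \<noteq> \<psi>'" for \<psi> \<psi>'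
    proof (rule ccontr)
      assume "\<not> ?thesis"
      \<comment> \<open>Outside the torus both characters take the value \<open>undefined\<close>,
        so a difference must show inside \<open>G\<close>.\<close>
      moreover have "\<psi> x = \<psi>' x" if "x \<notin> G" for x
        using that \<open>\<psi> \<in> \<chi> ` K\<close> \<open>\<psi>' \<in> \<chi> ` K\<close> by (auto simp: \<chi>_def torus_char_def G_def)
      ultimately have "\<psi> = \<psi>'"
        by blast
      with that show False
        by blast
    qed
    show "(\<Sum>\<psi>\<in>\<chi> ` K. coef \<psi> * \<psi> x) = 0" if x: "x \<in> G" for x
    proof -
      have "(\<Sum>\<psi>\<in>\<chi> ` K. coef \<psi> * \<psi> x) =
          (\<Sum>\<psi>\<in>\<chi> ` K. \<Sum>m\<in>{m\<in>K. \<chi> m = \<psi>}. Poly_Mapping.lookup f m * \<chi> m x)"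
        by (simp add: coef_def sum_distrib_right)
      also have "\<dots> = (\<Sum>m\<in>K. Poly_Mapping.lookup f m * \<chi> m x)"
        by (rule sum.image_gen[symmetric]) simp
      also have "\<dots> = msubst id (torus_point l p q x) f"
        by (simp add: subst \<chi>_apply[OF x])
      also have "\<dots> = 0"
        using x by (intro zero torus_point_time_reversible inj p) (auto simp: G_def)
      finally show ?thesis .
    qed
  qed (use that in simp_all)
  let ?c = "\<lambda>m. \<Prod>i=1..2 * l. c i ^ Poly_Mapping.lookup m i"
  have c_eq: "?c m = ?c m'" if "\<chi> m = \<chi> m'" for m m'
    using torus_char_eq_imp_monomial_eq[OF inf that[unfolded \<chi>_def]] c
    unfolding zero_set_sibirsky_ideal by blast
  have "(\<Sum>m\<in>{m\<in>K. \<chi> m = \<psi>}. Poly_Mapping.lookup f m * ?c m) = 0" if \<psi>: "\<psi> \<in> \<chi> ` K" for \<psi>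
  proof -
    obtain m' where m': "\<psi> = \<chi> m'"
      using \<psi> by blast
    \<comment> \<open>All monomials of one class agree at \<open>c\<close>, so their common value
      factors out and leaves \<open>coef \<psi>\<close>.\<close>
    have "(\<Sum>m\<in>{m\<in>K. \<chi> m = \<psi>}. Poly_Mapping.lookup f m * ?c m) =
        (\<Sum>m\<in>{m\<in>K. \<chi> m = \<psi>}. Poly_Mapping.lookup f m * ?c m')"
      using m' by (intro sum.cong refl arg_cong2[of _ _ _ _ "(*)"] c_eq) simp
    also have "\<dots> = coef \<psi> * ?c m'"
      by (simp add: coef_def sum_distrib_right)
    finally show ?thesis
      using coef_zero[OF \<psi>] by simp
  qed
  then show ?thesis
    unfolding subst by (subst sum.image_gen[of K _ \<chi>]) simp_all
qed

theorem theorem2: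
  fixes l :: nat and p :: "nat \<Rightarrow> int" and q :: "nat \<Rightarrow> nat"
  assumes "infinite (UNIV :: 'k::field set)"
    and "inj_on (\<lambda>j. (p j, q j)) {1..l}"
    and "\<And>j. j \<in> {1..l} \<Longrightarrow> p j \<ge> -1"
    and "\<And>j. j \<in> {1..l} \<Longrightarrow> p j + int (q j) \<ge> 0"
  shows "zariski_closure (2 * l) (time_reversible_systems l p q :: (nat \<Rightarrow> 'k) set) =
         zero_set (2 * l) (sibirsky_ideal l p q)"
  unfolding zariski_closure_def
proof (rule Least_equality, intro conjI subsetI)
  show "affine_variety (2 * l) (zero_set (2 * l) (sibirsky_ideal l p q :: (nat, 'k) mpoly set))"
    unfolding affine_variety_def using ideal_sibirsky_ideal by blast
next
  fix c :: "nat \<Rightarrow> 'k"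
  assume "c \<in> time_reversible_systems l p q"
  then show "c \<in> zero_set (2 * l) (sibirsky_ideal l p q)"
    using time_reversible_imp_binomial[of _ l c p q] time_reversible_iff[OF assms(2,3), of c]
    unfolding time_reversible_systems_def zero_set_sibirsky_ideal by blast
next
  fix V :: "(nat \<Rightarrow> 'k) set"
  assume V: "affine_variety (2 * l) V \<and> time_reversible_systems l p q \<subseteq> V"
  then obtain I where I: "ideal I (mpoly_ring {1..2 * l})" "V = zero_set (2 * l) I"
    unfolding affine_variety_def by blast
  show "zero_set (2 * l) (sibirsky_ideal l p q) \<subseteq> V"
  proof
    fix c :: "nat \<Rightarrow> 'k"
    assume c: "c \<in> zero_set (2 * l) (sibirsky_ideal l p q)"
    \<comment> \<open>Each equation of \<open>V\<close> holds on the time-reversible systems because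
      \<open>V\<close> contains them, and so it carries over to \<open>c\<close>.\<close>
    have "msubst id c f = 0" if "f \<in> I" for f
    proof (rule vanishing_on_time_reversible_systems[OF assms(1-3) _ _ c])
      show "f \<in> carrier (mpoly_ring {1..2 * l})"
        using ideal.Icarr[OF I(1) that] .
      show "msubst id x f = 0" if "x \<in> time_reversible_systems l p q" for x
        using V that \<open>f \<in> I\<close> by (auto simp: I(2) zero_set_def)
    qed
    then show "c \<in> V"
      using c by (simp add: I(2) zero_set_def)
  qed
qed

end
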